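(* $\displaystyle\lim_{k\to\infty,\ k\text{ odd}}\frac{\alpha\big(f_{\{(k+1)/2\},k}\big)}{\rho\big(f_{\{(k+1)/2\},k}\big)}=1.$
   Context: For $S\subseteq\{0,\dots,k\}$, $f_{S,k}:\mathbb Z_2^k\to\{0,1\}$ is given by $f_{S,k}(\mathbf a)=1$ iff the Hamming weight $\|\mathbf a\|_0\in S$. $\rho(f)=\mathbb E_{\mathbf a\sim\mathrm{Unif}(\mathbb Z_2^k)}[f(\mathbf a)]$ (so $\rho(f_{\{(k+1)/2\},k})=\binom{k}{(k+1)/2}2^{-k}$). $\mathcal B_p$ is the distribution on $\{0,1\}$ giving $0$ probability $p$ and $1$ probability $1-p$. For a distribution $\mathcal D$ on $\mathbb Z_2^k$: $\lambda_f(\mathcal D,p)=\mathbb E_{\mathbf b\sim\mathcal D,\mathbf a\sim\mathcal B_p^k}[f(\mathbf a+\mathbf b)]$, $\gamma_f(\mathcal D)=\lambda_f(\mathcal D,1)$, $\beta_f(\mathcal D)=\sup_{p\in[0,1]}\lambda_f(\mathcal D,p)$, $\boldsymbol\mu(\mathcal D)_i=-\mathbb E_{\mathbf a\sim\mathcal D}[(-1)^{a_i}]$, and $\alpha(f)=\inf\{\beta_f(\mathcal D_N)/\gamma_f(\mathcal D_Y):\boldsymbol\mu(\mathcal D_N)=\boldsymbol\mu(\mathcal D_Y)\}$ over pairs of distributions on $\mathbb Z_2^k$ (zero denominators read as $+\infty$). *)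

theory Defs
  imports "HOL-Probability.Probability" "HOL-Library.Z2"
begin

text \<open>
  The group \<open>\<int>\<^sub>2\<^sup>k\<close>: vectors are functions \<^typ>\<open>nat \<Rightarrow> bit\<close> with coordinates \<open>i < k\<close>, and value \<open>0\<close>
  at all \<open>i \<ge> k\<close>. The set is closed under pointwise addition in \<^typ>\<open>bit\<close>, and the default
  value agrees with the one used in \<open>Pi_pmf\<close> below.
\<close>

definition Z2_vec :: "nat \<Rightarrow> (nat \<Rightarrow> bit) set" where
  "Z2_vec k = PiE_dflt {..<k} 0 (\<lambda>_. UNIV)"

definition add_vec :: "(nat \<Rightarrow> bit) \<Rightarrow> (nat \<Rightarrow> bit) \<Rightarrow> nat \<Rightarrow> bit" where
  "add_vec a b = (\<lambda>i. a i + b i)"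

definition hamming_weight :: "nat \<Rightarrow> (nat \<Rightarrow> bit) \<Rightarrow> nat" where
  "hamming_weight k a = card {i. i < k \<and> a i \<noteq> 0}"

definition f_sym :: "nat set \<Rightarrow> nat \<Rightarrow> (nat \<Rightarrow> bit) \<Rightarrow> real" where
  "f_sym S k a = (if hamming_weight k a \<in> S then 1 else 0)"

definition rho :: "nat \<Rightarrow> ((nat \<Rightarrow> bit) \<Rightarrow> real) \<Rightarrow> real" where
  "rho k f = measure_pmf.expectation (pmf_of_set (Z2_vec k)) f"

text \<open>The parameter \<open>p\<close> is the probability of \<open>0\<close>, whereas that of \<open>bernoulli_pmf\<close> is the
  probability of \<open>True\<close>.\<close>

definition B_pmf :: "real \<Rightarrow> bit pmf" where
  "B_pmf p = map_pmf of_bool (bernoulli_pmf (1 - p))"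

definition B_vec_pmf :: "nat \<Rightarrow> real \<Rightarrow> (nat \<Rightarrow> bit) pmf" where
  "B_vec_pmf k p = Pi_pmf {..<k} 0 (\<lambda>_. B_pmf p)"

definition distributions :: "nat \<Rightarrow> (nat \<Rightarrow> bit) pmf set" where
  "distributions k = {D. set_pmf D \<subseteq> Z2_vec k}"

definition lam :: "nat \<Rightarrow> ((nat \<Rightarrow> bit) \<Rightarrow> real) \<Rightarrow> (nat \<Rightarrow> bit) pmf \<Rightarrow> real \<Rightarrow> real" where
  "lam k f D p =
     measure_pmf.expectation (pair_pmf D (B_vec_pmf k p)) (\<lambda>(b, a). f (add_vec a b))"

definition gam :: "nat \<Rightarrow> ((nat \<Rightarrow> bit) \<Rightarrow> real) \<Rightarrow> (nat \<Rightarrow> bit) pmf \<Rightarrow> real" where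
  "gam k f D = lam k f D 1"

definition bet :: "nat \<Rightarrow> ((nat \<Rightarrow> bit) \<Rightarrow> real) \<Rightarrow> (nat \<Rightarrow> bit) pmf \<Rightarrow> real" where
  "bet k f D = (SUP p\<in>{0..1}. lam k f D p)"

definition mu :: "(nat \<Rightarrow> bit) pmf \<Rightarrow> nat \<Rightarrow> real" where
  "mu D i = - measure_pmf.expectation D (\<lambda>a. if a i = 0 then 1 else -1)"

text \<open>The infimum is taken in the extended reals so that a zero denominator can count as \<open>\<infinity>\<close>,
  also for a zero numerator (in \<^typ>\<open>ereal\<close>, \<open>0 / 0 = 0\<close>).\<close>

definition ratio :: "real \<Rightarrow> real \<Rightarrow> ereal" where
  "ratio x y = (if y = 0 then \<infinity> else ereal (x / y))"

definition alpha :: "nat \<Rightarrow> ((nat \<Rightarrow> bit) \<Rightarrow> real) \<Rightarrow> ereal" where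
  "alpha k f = Inf {ratio (bet k f DN) (gam k f DY) |DN DY.
     DN \<in> distributions k \<and> DY \<in> distributions k \<and> (\<forall>i<k. mu DN i = mu DY i)}"

end

theory Submission
  imports Defs
begin

text \<open>
  At \<open>p = 1/2\<close> the noise is uniform, so \<open>\<beta>(D\<^sub>N) \<ge> \<rho>\<close> for every \<open>D\<^sub>N\<close>, and \<open>\<gamma> \<le> 1\<close> gives
  \<open>\<alpha> \<ge> \<rho>\<close>. For the converse let \<open>k = 2n + 1\<close>. The uniform distribution on the cyclic shifts of a
  vector of weight \<open>n + 1\<close> has \<open>\<gamma> = 1\<close> and all marginals \<open>\<mu>\<^sub>i = 1/k\<close>. The same marginals arise
  by choosing the all-ones vector with probability \<open>(n + 1)/k\<close> and the zero vector otherwise. For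
  the latter, with \<open>p = (1 + x)/2\<close>, one finds \<open>\<lambda>(p) = \<rho> (1 - x\<^sup>2)\<^sup>n (1 + x/k) \<le> \<rho> (1 + 1/k)\<close>.
\<close>

section \<open>The group and uniform noise\<close>

lemma finite_UNIV_bit: "finite (UNIV :: bit set)"
proof -
  have "x \<in> {0, 1}" for x :: bit by (cases x) simp_all
  hence "(UNIV :: bit set) \<subseteq> {0, 1}" by blast
  thus ?thesis by (rule finite_subset) simp
qed

lemma finite_Z2_vec: "finite (Z2_vec k)"
  unfolding Z2_vec_def by (intro finite_PiE_dflt) (simp_all add: finite_UNIV_bit)

lemma add_vec_zero: "add_vec a (\<lambda>_. 0) = a" "add_vec (\<lambda>_. 0) a = a"
proof -
  show "add_vec a (\<lambda>_. 0) = a"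
  proof
    fix i show "add_vec a (\<lambda>_. 0) i = a i"
      by (cases "a i") (simp_all add: add_vec_def)
  qed
  thus "add_vec (\<lambda>_. 0) a = a" by (simp add: add_vec_def add.commute)
qed

lemma zero_in_Z2_vec: "(\<lambda>_. 0) \<in> Z2_vec k"
  by (auto simp: Z2_vec_def PiE_dflt_def)

lemma bij_betw_add_vec:
  assumes "b \<in> Z2_vec k"
  shows "bij_betw (\<lambda>a. add_vec a b) (Z2_vec k) (Z2_vec k)"
proof -
  have invol: "add_vec (add_vec a b) b = a" for a
  proof
    fix i show "add_vec (add_vec a b) b i = a i"
      by (cases "b i"; cases "a i") (simp_all add: add_vec_def)
  qed
  have closed: "add_vec a b \<in> Z2_vec k" if "a \<in> Z2_vec k" for a
    using assms that by (simp add: add_vec_def Z2_vec_def PiE_dflt_def)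
  show ?thesis
    by (rule bij_betwI[where g = "\<lambda>a. add_vec a b"]) (simp_all add: invol closed)
qed

text \<open>A fair \<open>bernoulli_pmf\<close> is uniform on \<open>bit\<close>, and a product of
  uniform laws is uniform on the product set; the default \<open>0\<close> of \<open>Pi_pmf\<close>
  is the one in \<open>Z2_vec\<close>.\<close>

lemma B_vec_pmf_half: "B_vec_pmf k (1/2) = pmf_of_set (Z2_vec k)"
proof -
  have "B_pmf (1/2) = pmf_of_set UNIV"
  proof -
    have "bij (of_bool :: bool \<Rightarrow> bit)"
    proof (rule bijI)
      show "inj (of_bool :: bool \<Rightarrow> bit)" by (simp add: inj_def)
      have "y = of_bool (y = 1)" for y :: bit by (cases y) simp_all
      thus "surj (of_bool :: bool \<Rightarrow> bit)" unfolding surj_def by blast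
    qed
    thus ?thesis
      by (simp add: B_pmf_def bernoulli_pmf_half_conv_pmf_of_set map_pmf_of_set_bij_betw)
  qed
  thus ?thesis
    unfolding B_vec_pmf_def Z2_vec_def by (simp add: Pi_pmf_of_set finite_UNIV_bit)
qed

text \<open>Given \<open>b\<close>, a uniform vector translated by \<open>b\<close> is still
  uniform, so uniform noise erases all information about \<open>D\<close>.\<close>

lemma lam_half:
  assumes "D \<in> distributions k"
  shows "lam k f D (1/2) = rho k f"
proof -
  let ?U = "pmf_of_set (Z2_vec k)"
  have "map_pmf (\<lambda>(b, a). add_vec a b) (pair_pmf D ?U)
      = bind_pmf D (\<lambda>b. map_pmf (\<lambda>a. add_vec a b) ?U)"
    by (simp add: pair_pmf_def map_bind_pmf map_pmf_def bind_assoc_pmf bind_return_pmf)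
  also have "\<dots> = bind_pmf D (\<lambda>_. ?U)"
  proof (rule bind_pmf_cong[OF refl])
    fix b assume "b \<in> set_pmf D"
    hence "b \<in> Z2_vec k" using assms by (auto simp: distributions_def)
    thus "map_pmf (\<lambda>a. add_vec a b) ?U = ?U"
      using bij_betw_add_vec finite_Z2_vec zero_in_Z2_vec
      by (intro map_pmf_of_set_bij_betw) auto
  qed
  also have "\<dots> = ?U" by simp
  finally have "measure_pmf.expectation (map_pmf (\<lambda>(b, a). add_vec a b) (pair_pmf D ?U)) f
      = rho k f" by (simp add: rho_def)
  thus ?thesis by (simp add: lam_def B_vec_pmf_half case_prod_unfold)
qed

section \<open>Lower bound for the infimum\<close>

lemma lam_bounds:
  assumes "\<And>a. 0 \<le> f a" "\<And>a. f a \<le> 1"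
  shows "0 \<le> lam k f D p" "lam k f D p \<le> 1"
proof -
  show "0 \<le> lam k f D p"
    unfolding lam_def by (rule Bochner_Integration.integral_nonneg) (auto simp: assms)
  show "lam k f D p \<le> 1"
    unfolding lam_def
    by (rule measure_pmf.integral_le_const)
       (auto simp: assms intro!: measure_pmf.integrable_const_bound[where B = 1])
qed

lemma rho_le_alpha:
  assumes "\<And>a. 0 \<le> f a" "\<And>a. f a \<le> 1"
  shows "ereal (rho k f) \<le> alpha k f"
  unfolding alpha_def
proof (rule Inf_greatest, clarify)
  fix DN DY assume DN: "DN \<in> distributions k"
  note bounds = lam_bounds[where f = f, OF assms]
  \<comment> \<open>The value at \<open>p = 1/2\<close> is one member of the supremum;
    \<open>cSUP_upper\<close> needs the range to be bounded above, which \<open>bounds\<close>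
    provides.\<close>
  have "rho k f \<le> bet k f DN"
    unfolding bet_def lam_half[OF DN, symmetric]
    by (rule cSUP_upper) (auto intro!: bdd_aboveI[where M = 1] bounds)
  moreover have "0 \<le> rho k f"
    using bounds(1)[of k DN "1/2"] lam_half[OF DN] by simp
  moreover have "0 \<le> gam k f DY" "gam k f DY \<le> 1"
    unfolding gam_def by (fact bounds)+
  \<comment> \<open>As \<open>rho\<close> is nonnegative, a factor \<open>gam\<close> of at most 1
    cannot increase it, so \<open>rho * gam \<le> rho \<le> bet\<close>.\<close>
  ultimately have "gam k f DY \<noteq> 0 \<Longrightarrow> rho k f \<le> bet k f DN / gam k f DY"
    by (simp add: le_divide_eq) (smt (verit) mult_left_le)
  thus "ereal (rho k f) \<le> ratio (bet k f DN) (gam k f DY)"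
    by (auto simp: ratio_def)
qed

section \<open>Distribution of Hamming weights\<close>

lemma hamming_weight_B_vec_pmf:
  assumes "p \<in> {0..1}"
  shows "map_pmf (hamming_weight k) (B_vec_pmf k p) = binomial_pmf k (1 - p)"
proof -
  have "B_vec_pmf k p
      = map_pmf (\<lambda>h. of_bool \<circ> h) (Pi_pmf {..<k} False (\<lambda>_. bernoulli_pmf (1 - p)))"
    unfolding B_vec_pmf_def B_pmf_def by (rule Pi_pmf_map) auto
  hence "map_pmf (hamming_weight k) (B_vec_pmf k p)
      = map_pmf (\<lambda>h. card {i\<in>{..<k}. h i}) (Pi_pmf {..<k} False (\<lambda>_. bernoulli_pmf (1 - p)))"
    by (simp add: map_pmf_comp hamming_weight_def)
  also have "\<dots> = binomial_pmf k (1 - p)"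
    using assms by (intro binomial_pmf_altdef'[symmetric]) auto
  finally show ?thesis .
qed

text \<open>For a single weight \<open>f_sym\<close> is the indicator of a fibre of
  \<open>hamming_weight\<close>, so only the law of the weight matters.\<close>

lemma expectation_f_sym_singleton:
  "measure_pmf.expectation D (f_sym {m} k) = pmf (map_pmf (hamming_weight k) D) m"
proof -
  have "f_sym {m} k = indicator (hamming_weight k -` {m})"
    by (auto simp: f_sym_def indicator_def)
  thus ?thesis by (simp add: pmf_map)
qed

lemma rho_f_sym_singleton:
  assumes "m \<le> k"
  shows "rho k (f_sym {m} k) = real (k choose m) / 2 ^ k"
proof -
  have "rho k (f_sym {m} k) = pmf (binomial_pmf k (1/2)) m"
    by (simp add: rho_def expectation_f_sym_singleton B_vec_pmf_half[symmetric]
        hamming_weight_B_vec_pmf)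
  with assms show ?thesis
    by (simp add: power_add[symmetric] power_divide)
qed

section \<open>The two-point distribution and its noise\<close>

definition ones_vec :: "nat \<Rightarrow> nat \<Rightarrow> bit" where
  "ones_vec k = (\<lambda>i. of_bool (i < k))"

definition two_point_pmf :: "nat \<Rightarrow> real \<Rightarrow> (nat \<Rightarrow> bit) pmf" where
  "two_point_pmf k q = map_pmf (\<lambda>b. if b then ones_vec k else (\<lambda>_. 0)) (bernoulli_pmf q)"

lemma two_point_pmf_in_distributions: "two_point_pmf k q \<in> distributions k"
  by (auto simp: two_point_pmf_def distributions_def ones_vec_def Z2_vec_def PiE_dflt_def)

lemma mu_two_point_pmf:
  assumes "q \<in> {0..1}" "i < k"
  shows "mu (two_point_pmf k q) i = 2 * q - 1"
  using assms by (simp add: mu_def two_point_pmf_def ones_vec_def algebra_simps)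

lemma hamming_weight_add_ones_vec:
  "hamming_weight k (add_vec a (ones_vec k)) = k - hamming_weight k a"
proof -
  have "{i. i < k \<and> add_vec a (ones_vec k) i \<noteq> 0} = {..<k} - {i. i < k \<and> a i \<noteq> 0}"
    by (auto simp: add_vec_def ones_vec_def)
  thus ?thesis
    by (simp add: hamming_weight_def card_Diff_subset subset_iff)
qed

lemma hamming_weight_le: "hamming_weight k a \<le> k"
  using card_mono[of "{..<k}" "{i. i < k \<and> a i \<noteq> 0}"] by (auto simp: hamming_weight_def)

text \<open>The noise weight is binomial with success probability \<open>1 - p\<close>. The zero
  vector leaves it unchanged, whereas \<open>ones_vec\<close> reflects \<open>w\<close> to
  \<open>k - w\<close>; mixing with weights \<open>1 - q\<close> and \<open>q\<close> gives the two
  terms.\<close>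

lemma lam_two_point_pmf:
  assumes p: "p \<in> {0..1}" and q: "q \<in> {0..1}" and m: "m \<le> k"
  shows "lam k (f_sym {m} k) (two_point_pmf k q) p
    = real (k choose m) * (q * p ^ m * (1 - p) ^ (k - m) + (1 - q) * (1 - p) ^ m * p ^ (k - m))"
proof -
  let ?B = "B_vec_pmf k p" and ?h = "hamming_weight k"
  let ?T = "\<lambda>b. if b then ones_vec k else (\<lambda>_. 0)"
  have ones: "map_pmf (\<lambda>a. ?h (add_vec a (ones_vec k))) ?B = map_pmf (\<lambda>w. k - w) (map_pmf ?h ?B)"
    by (simp add: map_pmf_comp hamming_weight_add_ones_vec)
  \<comment> \<open>Truncated subtraction sends every \<open>w \<ge> k\<close> to 0, so for
    \<open>m = 0\<close> the fibre is a singleton only within \<open>{..k}\<close>, which carries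
    all the mass.\<close>
  have "(\<lambda>w. k - w) -` {m} \<inter> {..k} = {k - m}"
    using m by auto
  hence refl_m: "pmf (map_pmf (\<lambda>w. k - w) (map_pmf ?h ?B)) m = pmf (map_pmf ?h ?B) (k - m)"
    using hamming_weight_le
    by (subst pmf_map, subst measure_Int_set_pmf[symmetric])
       (auto simp: measure_pmf_single[symmetric] intro!: measure_pmf.finite_measure_eq_AE
         AE_pmfI)
  have "lam k (f_sym {m} k) (two_point_pmf k q) p
      = measure_pmf.expectation (map_pmf (\<lambda>(b, a). add_vec a b) (pair_pmf (two_point_pmf k q) ?B))
          (f_sym {m} k)"
    by (simp add: lam_def case_prod_unfold)
  also have "\<dots> = pmf (bind_pmf (bernoulli_pmf q) (\<lambda>b. map_pmf (\<lambda>a. ?h (add_vec a (?T b))) ?B)) m"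
    unfolding expectation_f_sym_singleton
    by (simp add: two_point_pmf_def pair_pmf_def map_pmf_def bind_assoc_pmf bind_return_pmf)
  also have "\<dots> = q * pmf (map_pmf ?h ?B) (k - m) + (1 - q) * pmf (map_pmf ?h ?B) m"
    using q by (simp add: pmf_bind ones refl_m) (simp add: add_vec_zero)
  also have "\<dots> = q * (real (k choose (k - m)) * (1 - p) ^ (k - m) * p ^ m)
      + (1 - q) * (real (k choose m) * (1 - p) ^ m * p ^ (k - m))"
    using p m by (simp add: hamming_weight_B_vec_pmf)
  finally show ?thesis
    using binomial_symmetric[OF m] by (simp add: algebra_simps)
qed

text \<open>Because \<open>n + 1\<close> and \<open>k - (n + 1) = n\<close> differ by one, both
  terms share the factor \<open>(p * (1 - p)) ^ n\<close> and leave a factor linear in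
  \<open>p\<close>. Bounding the two factors separately costs at most a factor
  \<open>1 + 1 / k\<close>.\<close>

lemma bet_two_point_pmf_le:
  fixes n :: nat
  defines "k \<equiv> 2 * n + 1" and "f \<equiv> f_sym {n + 1} (2 * n + 1)"
  shows "bet k f (two_point_pmf k ((n + 1) / k)) \<le> rho k f * (1 + 1 / k)"
  unfolding bet_def
proof (rule cSUP_least)
  fix p :: real assume p: "p \<in> {0..1}"
  define q where "q = real (n + 1) / real k"
  have q: "q \<in> {0..1}" "q = (1 + 1 / k) / 2"
    by (simp_all add: q_def k_def field_simps)
  have "lam k f (two_point_pmf k q) p
      = real (k choose (n + 1)) * (p * (1 - p)) ^ n * (q * p + (1 - q) * (1 - p))"
  proof -
    have n: "n + 1 \<le> k" "k - (n + 1) = n" and f: "f = f_sym {n + 1} k"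
      by (simp_all add: k_def f_def)
    show ?thesis
      unfolding f lam_two_point_pmf[OF p q(1) n(1)] n(2) power_mult_distrib
      by (simp add: algebra_simps)
  qed
  also have "\<dots> \<le> real (k choose (n + 1)) * (1 / 4) ^ n * ((1 + 1 / k) / 2)"
  proof (intro mult_mono power_mono)
    have "0 \<le> (p - 1/2)\<^sup>2" by simp
    thus "p * (1 - p) \<le> 1/4" by (simp add: power2_eq_square algebra_simps)
    \<comment> \<open>As \<open>q\<close> is at least 1/2, replacing \<open>1 - q\<close> by
      \<open>q\<close> bounds the linear factor by \<open>q * p + q * (1 - p) = q\<close>.\<close>
    have "1 - q \<le> q" unfolding q(2) add_divide_distrib by simp
    hence "(1 - q) * (1 - p) \<le> q * (1 - p)" using p by (intro mult_right_mono) auto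
    thus "q * p + (1 - q) * (1 - p) \<le> (1 + 1 / k) / 2"
      unfolding q(2)[symmetric] by (simp add: algebra_simps)
    show "0 \<le> q * p + (1 - q) * (1 - p)"
      using p q(1) by (intro add_nonneg_nonneg mult_nonneg_nonneg) auto
  qed (use p q in auto)
  \<comment> \<open>Here \<open>(1/4) ^ n / 2\<close> is \<open>1 / 2 ^ k\<close>.\<close>
  also have "\<dots> = rho k f * (1 + 1 / k)"
    by (simp add: f_def k_def rho_f_sym_singleton power_mult power_divide)
  finally show "lam k f (two_point_pmf k (real (n + 1) / real k)) p \<le> rho k f * (1 + 1 / k)"
    by (simp add: q_def)
qed simp

section \<open>Cyclic shifts\<close>

text \<open>A block of \<open>m\<close> ones rotated by \<open>j\<close>. For indices below
  \<open>k\<close> the condition is symmetric in \<open>i\<close> and \<open>j\<close>, so one count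
  serves both the weight of a shift and the marginal at a coordinate. The guard \<open>i < k\<close>
  keeps the vector in \<open>Z2_vec\<close>.\<close>

definition shift_vec :: "nat \<Rightarrow> nat \<Rightarrow> nat \<Rightarrow> nat \<Rightarrow> bit" where
  "shift_vec k m j = (\<lambda>i. of_bool (i < k \<and> (i + j) mod k < m))"

definition shift_pmf :: "nat \<Rightarrow> nat \<Rightarrow> (nat \<Rightarrow> bit) pmf" where
  "shift_pmf k m = map_pmf (shift_vec k m) (pmf_of_set {..<k})"

lemma shift_pmf_in_distributions: "shift_pmf k m \<in> distributions k"
  by (auto simp: shift_pmf_def distributions_def shift_vec_def Z2_vec_def PiE_dflt_def)

text \<open>Translation by \<open>j\<close> permutes the residues modulo \<open>k\<close>, so
  exactly \<open>m\<close> indices land in \<open>{..<m}\<close>.\<close>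

lemma card_add_mod_less:
  assumes "m \<le> (k::nat)"
  shows "card {i. i < k \<and> (i + j) mod k < m} = m"
proof -
  have inj: "inj_on (\<lambda>i. (i + j) mod k) {..<k}"
  proof (rule linorder_inj_onI')
    fix x y assume "x \<in> {..<k}" "y \<in> {..<k}" "x < y"
    \<comment> \<open>The difference is \<open>y - x\<close>, which lies strictly between 0 and
      \<open>k\<close>.\<close>
    hence "\<not> k dvd (y + j) - (x + j)" by (auto dest!: dvd_imp_le)
    thus "(x + j) mod k \<noteq> (y + j) mod k"
      using \<open>x < y\<close> mod_eq_dvd_iff_nat[of "x + j" "y + j" k] by auto
  qed
  have "(\<lambda>i. (i + j) mod k) ` {..<k} = {..<k}"
    using inj by (intro endo_inj_surj) auto
  hence "{..<m} = (\<lambda>i. (i + j) mod k) ` {..<k} \<inter> {..<m}"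
    using assms by auto
  also have "\<dots> = (\<lambda>i. (i + j) mod k) ` {i. i < k \<and> (i + j) mod k < m}"
    by blast
  finally have "(\<lambda>i. (i + j) mod k) ` {i. i < k \<and> (i + j) mod k < m} = {..<m}" ..
  thus ?thesis
    using card_image[OF inj_on_subset[OF inj], of "{i. i < k \<and> (i + j) mod k < m}"]
    by (simp add: subset_iff)
qed

lemma hamming_weight_shift_vec:
  assumes "m \<le> k"
  shows "hamming_weight k (shift_vec k m j) = m"
proof -
  have "{i. i < k \<and> shift_vec k m j i \<noteq> 0} = {i. i < k \<and> (i + j) mod k < m}"
    by (auto simp: shift_vec_def)
  thus ?thesis by (simp add: hamming_weight_def card_add_mod_less[OF assms])
qed

lemma mu_shift_pmf:
  assumes "m \<le> k" "i < k"
  shows "mu (shift_pmf k m) i = 2 * (m / k) - 1"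
proof -
  have ne: "{..<k} \<noteq> {}" using assms by auto
  \<comment> \<open>The roles of shift and coordinate are exchanged, so that the count over
    \<open>i\<close> becomes a count over \<open>j\<close>.\<close>
  have eq: "{..<k} \<inter> {j. (i + j) mod k < m} = {j. j < k \<and> (j + i) mod k < m}"
    by (auto simp: add.commute)
  have "mu (shift_pmf k m) i
      = - ((\<Sum>j<k. (if (i + j) mod k < m then -1 else 1)) / real k)"
    using assms ne
    by (auto simp: mu_def shift_pmf_def integral_pmf_of_set shift_vec_def intro!: sum.cong split: if_splits)
  also have "(\<Sum>j<k. (if (i + j) mod k < m then -1 else 1))
      = (\<Sum>j<k. 1 - 2 * (if (i + j) mod k < m then 1 else 0 :: real))"
    by (intro sum.cong) auto
  also have "\<dots> = real k - 2 * real m"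
    by (simp add: sum_subtractf sum_distrib_left[symmetric] sum.If_cases eq
        card_add_mod_less[OF assms(1)])
  finally show ?thesis using assms by (simp add: field_simps)
qed

text \<open>At \<open>p = 1\<close> every noise coordinate is 0 almost surely, so the noise is the
  zero vector.\<close>

lemma lam_one: "lam k f D 1 = measure_pmf.expectation D f"
proof -
  have "B_vec_pmf k 1 = return_pmf (\<lambda>_. 0)"
  proof -
    have "bernoulli_pmf 0 = return_pmf False"
    proof (rule pmf_eqI)
      fix b show "pmf (bernoulli_pmf 0) b = pmf (return_pmf False) b" by (cases b) simp_all
    qed
    thus ?thesis by (simp add: B_vec_pmf_def B_pmf_def)
  qed
  thus ?thesis
    by (simp add: lam_def pair_return_pmf2 add_vec_zero)
qed

lemma gam_shift_pmf:
  assumes "m \<le> k"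
  shows "gam k (f_sym {m} k) (shift_pmf k m) = 1"
  by (simp add: gam_def lam_one shift_pmf_def f_sym_def hamming_weight_shift_vec[OF assms])

section \<open>Upper bound and limit\<close>

lemma alpha_f_sym_middle_le:
  fixes n :: nat
  defines "k \<equiv> 2 * n + 1" and "f \<equiv> f_sym {n + 1} (2 * n + 1)"
  shows "alpha k f \<le> ereal (rho k f * (1 + 1 / k))"
proof -
  let ?N = "two_point_pmf k ((n + 1) / k)" and ?Y = "shift_pmf k (n + 1)"
  \<comment> \<open>Both sides equal \<open>2 * (n + 1) / k - 1 = 1 / k\<close>.\<close>
  have "\<forall>i<k. mu ?N i = mu ?Y i"
    by (auto simp: mu_two_point_pmf mu_shift_pmf k_def)
  hence "alpha k f \<le> ratio (bet k f ?N) (gam k f ?Y)"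
    unfolding alpha_def
    by (intro Inf_lower CollectI exI[of _ ?N] exI[of _ ?Y] conjI refl
        two_point_pmf_in_distributions shift_pmf_in_distributions)
  also have "\<dots> = ereal (bet k f ?N)"
    by (simp add: ratio_def f_def k_def gam_shift_pmf)
  also have "\<dots> \<le> ereal (rho k f * (1 + 1 / k))"
    unfolding k_def f_def ereal_less_eq by (rule bet_two_point_pmf_le)
  finally show ?thesis .
qed

theorem theorem7p5:
  shows "((\<lambda>k. alpha k (f_sym {(k + 1) div 2} k) / ereal (rho k (f_sym {(k + 1) div 2} k)))
           \<longlongrightarrow> 1) (inf sequentially (principal {k. odd k}))"
proof (rule tendsto_sandwich)
  let ?F = "inf sequentially (principal {k::nat. odd k})"
  let ?f = "\<lambda>k. f_sym {(k + 1) div 2} k"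
  have bounds: "1 \<le> alpha k (?f k) / ereal (rho k (?f k))
      \<and> alpha k (?f k) / ereal (rho k (?f k)) \<le> ereal (1 + 1 / k)" if "odd k" for k
  proof -
    obtain n where k: "k = 2 * n + 1" using \<open>odd k\<close> by (elim oddE)
    have pos: "0 < rho k (?f k)"
      by (simp add: rho_f_sym_singleton k del: binomial_Suc_Suc)
    have "ereal (rho k (?f k)) \<le> alpha k (?f k)"
      by (rule rho_le_alpha) (auto simp: f_sym_def)
    moreover have "alpha k (?f k) \<le> ereal (rho k (?f k) * (1 + 1 / k))"
      using alpha_f_sym_middle_le[of n] by (simp add: k)
    \<comment> \<open>The two finite bounds exclude infinite values of \<open>alpha\<close>; with
      \<open>rho\<close> positive the claim becomes one about real quotients.\<close>
    ultimately show ?thesis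
      using pos by (cases "alpha k (?f k)") (simp_all add: field_simps)
  qed
  show "\<forall>\<^sub>F k in ?F. 1 \<le> alpha k (?f k) / ereal (rho k (?f k))"
    using bounds by (simp add: eventually_inf_principal)
  show "\<forall>\<^sub>F k in ?F. alpha k (?f k) / ereal (rho k (?f k)) \<le> ereal (1 + 1 / k)"
    using bounds by (simp add: eventually_inf_principal)
  have "(\<lambda>k. 1 + 1 / real k) \<longlonglongrightarrow> 1 + 0"
    by (intro tendsto_intros lim_1_over_n)
  hence "(\<lambda>k. ereal (1 + 1 / real k)) \<longlonglongrightarrow> 1" by (simp add: one_ereal_def)
  \<comment> \<open>Convergence along all \<open>k\<close> passes to the finer filter of odd
    \<open>k\<close>.\<close>
  thus "((\<lambda>k. ereal (1 + 1 / real k)) \<longlongrightarrow> 1) ?F"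
    by (rule tendsto_mono[rotated]) simp
qed simp

end
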